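(* For any nonlocal game $\mathcal G(\pi,V)$ we have $\omega_{\mathcal Q}(\mathcal G)\le\omega(\mathcal{DNN},\mathcal G)\le\omega_{\mathcal{NS}}(\mathcal G)$.
   Context: A nonlocal game $\mathcal G(\pi,V)$ consists of finite nonempty sets $S,T$ (questions), $A,B$ (answers), a probability distribution $\pi$ on $S\times T$ and a predicate $V:A\times B\times S\times T\to\{0,1\}$, written $V(a,b|s,t)$. $\mathcal{P}$: vectors $p=(p(a,b|s,t))$ with $p(a,b|s,t)\ge 0$ and $\sum_{a,b}p(a,b|s,t)=1$ for all $s,t$. $\mathcal{Q}$: $p\in\mathcal P$ such that there are finite-dimensional complex Euclidean spaces $\mathcal X,\mathcal Y$, a unit vector $\psi\in\mathcal X\otimes\mathcal Y$, Hermitian psd operators $X_a^s$ on $\mathcal X$ with $\sum_{a\in A} X_a^s=\mathbb I_{\mathcal X}$ for each $s$, and Hermitian psd operators $Y_b^t$ on $\mathcal Y$ with $\sum_{b\in B} Y_b^t=\mathbb I_{\mathcal Y}$ for each $t$, with $p(a,b|s,t)=\psi^*(X_a^s\otimes Y_b^t)\psi$. $\mathcal{NS}$: $p\in\mathcal P$ with $\sum_b p(a,b|s,t)=\sum_b p(a,b|s,t')$ for all $a,s,t\neq t'$, and $\sum_a p(a,b|s,t)=\sum_a p(a,b|s',t)$ for all $b,t,s\ne s'$. For $\mathcal R\in\{\mathcal Q,\mathcal{NS}\}$, $\omega_{\mathcal R}(\mathcal G):=\sup\{\sum_{s,t}\pi(s,t)\sum_{a,b}V(a,b|s,t)p(a,b|s,t):p\in\mathcal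 R\}$. Let $N=|S||A|+|T||B|$; real symmetric $N\times N$ matrices are indexed by the disjoint union of $S\times A$ and $T\times B$ (in $S\cup T$, $S$ and $T$ are regarded as disjoint). $\mathcal{DNN}^N$ is the set of real symmetric psd $N\times N$ matrices with all entries nonnegative. $\langle J_{i,j},X\rangle:=\sum_{k,l}X[(i,k),(j,l)]$ is the sum of entries of block $(i,j)$, $i,j\in S\cup T$. Let $C[(s,a),(t,b)]=\pi(s,t)V(a,b|s,t)$, $\hat C=\frac12\begin{pmatrix}0&C\\C^{\mathsf T}&0\end{pmatrix}$, and $$\omega(\mathcal{DNN},\mathcal G):=\sup\{\mathrm{Tr}(\hat CX):\langle J_{i,j},X\rangle=1\ \forall i,j\in S\cup T,\ X\in\mathcal{DNN}^N\}.$$ *)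

theory Defs
  imports "HOL-Analysis.Analysis" "Jordan_Normal_Form.Schur_Decomposition"
begin

text \<open>
  The finite nonempty sets \<open>S\<close>, \<open>T\<close>, \<open>A\<close>, \<open>B\<close> are the finite types \<open>'s\<close>, \<open>'t\<close>, \<open>'a\<close>, \<open>'b\<close>.
  Real matrices indexed by them are the matrices of \<open>HOL-Analysis\<close>. Since the dimensions of the
  quantum systems are existentially quantified, operators on them are the carrier-based matrices of
  \<open>Jordan_Normal_Form\<close>.
\<close>

no_notation vec_index (infixl \<open>$\<close> 100)
no_notation scalar_prod (infix \<open>\<bullet>\<close> 70)

type_synonym ('s, 't, 'a, 'b) correlation = "'a \<Rightarrow> 'b \<Rightarrow> 's \<Rightarrow> 't \<Rightarrow> real"

definition prob_distribution :: "('s::finite \<Rightarrow> 't::finite \<Rightarrow> real) \<Rightarrow> bool" where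
  "prob_distribution \<pi> \<longleftrightarrow> (\<forall>s t. 0 \<le> \<pi> s t) \<and> (\<Sum>s\<in>UNIV. \<Sum>t\<in>UNIV. \<pi> s t) = 1"

definition correlations :: "('s::finite, 't::finite, 'a::finite, 'b::finite) correlation set" where
  "correlations = {p. (\<forall>a b s t. 0 \<le> p a b s t) \<and>
     (\<forall>s t. (\<Sum>a\<in>UNIV. \<Sum>b\<in>UNIV. p a b s t) = 1)}"

definition psd_operator :: "nat \<Rightarrow> complex mat \<Rightarrow> bool" where
  "psd_operator n M \<longleftrightarrow> M \<in> carrier_mat n n \<and> mat_adjoint M = M \<and>
     (\<forall>v\<in>carrier_vec n. 0 \<le> Re ((M *\<^sub>v v) \<bullet>c v))"

definition measurement :: "nat \<Rightarrow> ('a::finite \<Rightarrow> complex mat) \<Rightarrow> bool" where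
  "measurement n M \<longleftrightarrow> (\<forall>a. psd_operator n (M a)) \<and>
     Matrix.mat n n (\<lambda>ij. \<Sum>a\<in>UNIV. M a $$ ij) = 1\<^sub>m n"

text \<open>Kronecker product, identifying the tensor product of \<open>n\<close>- and \<open>m\<close>-dimensional space with
  \<open>n * m\<close>-dimensional space.\<close>

definition kronecker :: "complex mat \<Rightarrow> complex mat \<Rightarrow> complex mat" where
  "kronecker M K = Matrix.mat (dim_row M * dim_row K) (dim_col M * dim_col K)
     (\<lambda>(i, j). M $$ (i div dim_row K, j div dim_col K) * K $$ (i mod dim_row K, j mod dim_col K))"

text \<open>\<open>v \<bullet>c w\<close> is conjugate-linear in \<open>w\<close>, so \<open>(M *\<^sub>v \<psi>) \<bullet>c \<psi>\<close> is \<open>\<psi>\<^sup>* M \<psi>\<close>.\<close>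

definition quantum_correlations ::
    "('s::finite, 't::finite, 'a::finite, 'b::finite) correlation set" where
  "quantum_correlations = {p \<in> correlations.
     \<exists>n m \<psi> (X :: 's \<Rightarrow> 'a \<Rightarrow> complex mat) (Y :: 't \<Rightarrow> 'b \<Rightarrow> complex mat).
       \<psi> \<in> carrier_vec (n * m) \<and> \<psi> \<bullet>c \<psi> = 1 \<and>
       (\<forall>s. measurement n (X s)) \<and> (\<forall>t. measurement m (Y t)) \<and>
       (\<forall>a b s t. complex_of_real (p a b s t) = (kronecker (X s a) (Y t b) *\<^sub>v \<psi>) \<bullet>c \<psi>)}"

definition nonsignaling_correlations ::
    "('s::finite, 't::finite, 'a::finite, 'b::finite) correlation set" where
  "nonsignaling_correlations = {p \<in> correlations.
     (\<forall>a s t t'. t \<noteq> t' \<longrightarrow> (\<Sum>b\<in>UNIV. p a b s t) = (\<Sum>b\<in>UNIV. p a b s t')) \<and>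
     (\<forall>b t s s'. s \<noteq> s' \<longrightarrow> (\<Sum>a\<in>UNIV. p a b s t) = (\<Sum>a\<in>UNIV. p a b s' t))}"

definition winning_prob :: "('s::finite \<Rightarrow> 't::finite \<Rightarrow> real) \<Rightarrow>
    ('a::finite \<Rightarrow> 'b::finite \<Rightarrow> 's \<Rightarrow> 't \<Rightarrow> bool) \<Rightarrow> ('s, 't, 'a, 'b) correlation \<Rightarrow> real" where
  "winning_prob \<pi> V p =
     (\<Sum>s\<in>UNIV. \<Sum>t\<in>UNIV. \<pi> s t * (\<Sum>a\<in>UNIV. \<Sum>b\<in>UNIV. of_bool (V a b s t) * p a b s t))"

text \<open>For a game, the suprema below are over nonempty sets of reals that are bounded above (by 1),
  so \<open>Sup\<close> on the reals is the usual supremum.\<close>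

definition quantum_value :: "('s::finite \<Rightarrow> 't::finite \<Rightarrow> real) \<Rightarrow>
    ('a::finite \<Rightarrow> 'b::finite \<Rightarrow> 's \<Rightarrow> 't \<Rightarrow> bool) \<Rightarrow> real" where
  "quantum_value \<pi> V = (SUP p\<in>quantum_correlations. winning_prob \<pi> V p)"

definition nonsignaling_value :: "('s::finite \<Rightarrow> 't::finite \<Rightarrow> real) \<Rightarrow>
    ('a::finite \<Rightarrow> 'b::finite \<Rightarrow> 's \<Rightarrow> 't \<Rightarrow> bool) \<Rightarrow> real" where
  "nonsignaling_value \<pi> V = (SUP p\<in>nonsignaling_correlations. winning_prob \<pi> V p)"

definition DNN :: "(real ^ 'n ^ 'n) set" where
  "DNN = {X. Finite_Cartesian_Product.transpose X = X \<and> (\<forall>v. 0 \<le> v \<bullet> (X *v v)) \<and>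
     (\<forall>k l. 0 \<le> X $ k $ l)}"

fun block :: "'s + 't \<Rightarrow> ('s \<times> 'a + 't \<times> 'b) set" where
  "block (Inl s) = range (\<lambda>a. Inl (s, a))"
| "block (Inr t) = range (\<lambda>b. Inr (t, b))"

definition block_sum :: "'s + 't \<Rightarrow> 's + 't \<Rightarrow>
    real ^ ('s::finite \<times> 'a::finite + 't::finite \<times> 'b::finite) ^ ('s \<times> 'a + 't \<times> 'b) \<Rightarrow> real" where
  "block_sum i j X = (\<Sum>k\<in>block i. \<Sum>l\<in>block j. X $ k $ l)"

definition cost :: "('s::finite \<Rightarrow> 't::finite \<Rightarrow> real) \<Rightarrow>
    ('a::finite \<Rightarrow> 'b::finite \<Rightarrow> 's \<Rightarrow> 't \<Rightarrow> bool) \<Rightarrow> real ^ ('t \<times> 'b) ^ ('s \<times> 'a)" where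
  "cost \<pi> V = (\<chi> k l. case k of (s, a) \<Rightarrow> case l of (t, b) \<Rightarrow> \<pi> s t * of_bool (V a b s t))"

definition sym_cost :: "('s::finite \<Rightarrow> 't::finite \<Rightarrow> real) \<Rightarrow>
    ('a::finite \<Rightarrow> 'b::finite \<Rightarrow> 's \<Rightarrow> 't \<Rightarrow> bool) \<Rightarrow>
    real ^ ('s \<times> 'a + 't \<times> 'b) ^ ('s \<times> 'a + 't \<times> 'b)" where
  "sym_cost \<pi> V = (1/2) *\<^sub>R (\<chi> k l. case k of
       Inl x \<Rightarrow> (case l of Inl _ \<Rightarrow> 0 | Inr y \<Rightarrow> cost \<pi> V $ x $ y)
     | Inr y \<Rightarrow> (case l of Inl x \<Rightarrow> Finite_Cartesian_Product.transpose (cost \<pi> V) $ y $ x | Inr _ \<Rightarrow> 0))"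

definition DNN_value :: "('s::finite \<Rightarrow> 't::finite \<Rightarrow> real) \<Rightarrow>
    ('a::finite \<Rightarrow> 'b::finite \<Rightarrow> 's \<Rightarrow> 't \<Rightarrow> bool) \<Rightarrow> real" where
  "DNN_value \<pi> V =
     (SUP X\<in>{X \<in> DNN. \<forall>i j. block_sum i j X = 1}. Determinants.trace (sym_cost \<pi> V ** X))"

end

theory Submission
  imports Defs
begin

text \<open>
  Upper bound: for a feasible \<open>X\<close>, the entries of its off-diagonal blocks form a correlation. The
  difference \<open>v\<close> of the indicator vectors of two blocks satisfies \<open>v\<^sup>T X v = 1 - 1 - 1 + 1 = 0\<close>, so
  \<open>X v = 0\<close> because \<open>X\<close> is positive semidefinite, and this is the nonsignaling condition.

  Lower bound: let \<open>\<psi> = \<Sum>\<^sub>\<alpha> u\<^sub>\<alpha> \<otimes> l\<^sub>\<alpha>\<close> be a Schmidt decomposition with \<open>u\<close> orthonormal, \<open>l\<close>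
  orthogonal and \<open>\<parallel>l\<^sub>\<alpha>\<parallel>\<^sup>2 = r\<^sub>\<alpha>\<^sup>4\<close>. The positive semidefinite matrices with entries
  \<open>r\<^sub>\<alpha> r\<^sub>\<beta> \<langle>u\<^sub>\<alpha>, X\<^sub>a u\<^sub>\<beta>\<rangle>\<close> for the answers of the first player and the conjugates of
  \<open>\<langle>l\<^sub>\<alpha>, Y\<^sub>b l\<^sub>\<beta>\<rangle> / (r\<^sub>\<alpha> r\<^sub>\<beta>)\<close> for those of the second have \<open>p(a,b|s,t)\<close> as their
  Hilbert-Schmidt inner products, and they sum to the same matrix \<open>diag(r\<^sub>\<alpha>\<^sup>2)\<close> for every question.
  Inner products of positive semidefinite matrices are nonnegative, so the Gram matrix of the whole
  family is doubly nonnegative; all its block sums equal the squared norm of that diagonal matrix.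
\<close>

section \<open>Hermitian and positive semidefinite forms\<close>

text \<open>Vectors and matrices are plain functions on the naturals of which only the indices below
  \<open>n\<close> count. Linear combinations and restrictions to subspaces then need no carrier
  conditions.\<close>

definition sesq :: "nat \<Rightarrow> (nat \<Rightarrow> nat \<Rightarrow> complex) \<Rightarrow> (nat \<Rightarrow> complex) \<Rightarrow> (nat \<Rightarrow> complex) \<Rightarrow> complex" where
  "sesq n H f g = (\<Sum>i<n. \<Sum>j<n. cnj (f i) * H i j * g j)"

definition cinner :: "nat \<Rightarrow> (nat \<Rightarrow> complex) \<Rightarrow> (nat \<Rightarrow> complex) \<Rightarrow> complex" where
  "cinner n f g = (\<Sum>i<n. cnj (f i) * g i)"

definition hermitian :: "nat \<Rightarrow> (nat \<Rightarrow> nat \<Rightarrow> complex) \<Rightarrow> bool" where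
  "hermitian n H \<longleftrightarrow> (\<forall>i<n. \<forall>j<n. H j i = cnj (H i j))"

definition orthonormal :: "nat \<Rightarrow> (nat \<Rightarrow> nat \<Rightarrow> complex) \<Rightarrow> bool" where
  "orthonormal n u \<longleftrightarrow> (\<forall>a<n. \<forall>b<n. cinner n (u a) (u b) = of_bool (a = b))"

lemma sesq_linear_combination:
  "sesq n H (\<lambda>i. \<Sum>a<k. c a * w a i) (\<lambda>j. \<Sum>b<l. d b * w' b j) =
     (\<Sum>a<k. \<Sum>b<l. cnj (c a) * sesq n H (w a) (w' b) * d b)"
proof -
  have "sesq n H (\<lambda>i. \<Sum>a<k. c a * w a i) (\<lambda>j. \<Sum>b<l. d b * w' b j)
      = (\<Sum>i<n. \<Sum>j<n. \<Sum>a<k. \<Sum>b<l. cnj (c a) * (cnj (w a i) * H i j * w' b j) * d b)"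
    unfolding sesq_def cnj_sum sum_distrib_right sum_product
    by (intro sum.cong refl) (simp add: sum_distrib_left mult_ac)
  also have "\<dots> = (\<Sum>a<k. \<Sum>b<l. \<Sum>i<n. \<Sum>j<n. cnj (c a) * (cnj (w a i) * H i j * w' b j) * d b)"
    by (simp only: sum.swap[of _ "{..<n}" "{..<k}"] sum.swap[of _ "{..<n}" "{..<l}"])
  also have "\<dots> = (\<Sum>a<k. \<Sum>b<l. cnj (c a) * sesq n H (w a) (w' b) * d b)"
    by (simp only: sesq_def sum_distrib_left sum_distrib_right)
  finally show ?thesis .
qed

lemma sesq_identity: "sesq n (\<lambda>i j. of_bool (i = j)) f g = cinner n f g"
  unfolding sesq_def cinner_def
proof (rule sum.cong[OF refl])
  fix i assume "i \<in> {..<n}"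
  then show "(\<Sum>j<n. cnj (f i) * of_bool (i = j) * g j) = cnj (f i) * g i"
    by (subst sum.remove[of _ i]) (auto intro!: sum.neutral)
qed

lemma sesq_cnj:
  assumes "hermitian n H"
  shows "cnj (sesq n H f g) = sesq n H g f"
proof -
  have "cnj (H j i) = H i j" if "i < n" "j < n" for i j
    using assms that unfolding hermitian_def by metis
  then show ?thesis
    unfolding sesq_def by (subst sum.swap) (auto intro!: sum.cong)
qed

lemma cinner_linear_combination:
  "cinner n (\<lambda>i. \<Sum>a<k. c a * w a i) (\<lambda>j. \<Sum>b<l. d b * w' b j) =
     (\<Sum>a<k. \<Sum>b<l. cnj (c a) * cinner n (w a) (w' b) * d b)"
  using sesq_linear_combination[of n "\<lambda>i j. of_bool (i = j)"] by (simp only: sesq_identity)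

text \<open>Orthonormality says that the conjugate transpose of the square matrix \<open>U\<close>
  is a left inverse of it; a left inverse of a square matrix is also a right inverse.\<close>

lemma orthonormal_complete:
  assumes "orthonormal n u" "i < n" "j < n"
  shows "(\<Sum>a<n. u a i * cnj (u a j)) = of_bool (i = j)"
proof -
  define U where "U = Matrix.mat n n (\<lambda>(i, a). u a i)"
  define W where "W = Matrix.mat n n (\<lambda>(a, i). cnj (u a i))"
  have U: "U \<in> carrier_mat n n" and W: "W \<in> carrier_mat n n"
    by (auto simp: U_def W_def)
  have "W * U = 1\<^sub>m n"
    using assms(1)
    by (intro eq_matI) (auto simp: U_def W_def scalar_prod_def orthonormal_def cinner_def lessThan_atLeast0)
  then have "U * W = 1\<^sub>m n"
    by (rule mat_mult_left_right_inverse[OF W U])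
  then have "(U * W) $$ (i, j) = 1\<^sub>m n $$ (i, j)" by simp
  then show ?thesis
    using assms(2,3) by (auto simp: U_def W_def scalar_prod_def lessThan_atLeast0)
qed

text \<open>Complete \<open>v\<close> to a basis and apply Gram-Schmidt, which keeps the first
  vector. The result is only orthogonal, so each vector is divided by its norm; \<open>c\<close> is
  the factor this puts on \<open>v\<close>.\<close>

lemma exists_orthonormal_extension:
  assumes "v \<in> carrier_vec n" "v \<noteq> 0\<^sub>v n"
  obtains u c where "orthonormal n u" "\<And>i. i < n \<Longrightarrow> u 0 i = c * Matrix.vec_index v i"
proof -
  interpret cof_vec_space n "TYPE(complex)" .
  define b where "b = basis_completion v"
  define ws where "ws = gram_schmidt n b"
  note B = basis_completion[OF assms, folded b_def]
  obtain vs where bv: "b = v # vs"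
    unfolding b_def basis_completion_def Let_def by simp
  from gram_schmidt_result[OF B(2,4,5) refl, folded ws_def] B(6)
  have ws: "set ws \<subseteq> carrier_vec n" "corthogonal ws" "length ws = n" by auto
  have n: "n > 0" using B(6) bv by auto
  have hd: "ws ! 0 = v"
    using gram_schmidt_hd[OF assms(1), of vs, folded bv] ws(3) n
    unfolding ws_def by (metis hd_conv_nth length_greater_0_conv)
  define nrm where "nrm a = sqrt (\<Sum>i<n. (cmod (Matrix.vec_index (ws ! a) i))\<^sup>2)" for a
  define u where "u a i = Matrix.vec_index (ws ! a) i / of_real (nrm a)" for a i
  have carr: "ws ! a \<in> carrier_vec n" if "a < n" for a using ws that by auto
  have ip: "(ws ! b) \<bullet>c (ws ! a) = (\<Sum>i<n. cnj (Matrix.vec_index (ws ! a) i) * Matrix.vec_index (ws ! b) i)"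
    if "a < n" "b < n" for a b
    using carr[OF that(1)] carr[OF that(2)] by (auto simp: scalar_prod_def lessThan_atLeast0 mult.commute)
  have self: "(ws ! a) \<bullet>c (ws ! a) = of_real ((nrm a)\<^sup>2)" if "a < n" for a
    unfolding ip[OF that that] nrm_def
    by (simp add: sum_nonneg mult.commute flip: complex_norm_square)
  have "cinner n (u a) (u b) = of_bool (a = b)" if "a < n" "b < n" for a b
  proof -
    have "cinner n (u a) (u b) = (ws ! b) \<bullet>c (ws ! a) / of_real (nrm a * nrm b)"
      unfolding cinner_def u_def ip[OF that] by (simp add: sum_divide_distrib)
    also have "\<dots> = of_bool (a = b)"
    proof (cases "a = b")
      case True
      have "nrm b \<noteq> 0"
        using corthogonalD[OF ws(2), of b b] self[of b] that ws(3) by auto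
      then show ?thesis using True self[of b] that by (simp add: power2_eq_square)
    next
      case False
      then show ?thesis using corthogonalD[OF ws(2), of b a] that ws(3) by auto
    qed
    finally show ?thesis .
  qed
  then have "orthonormal n u" by (simp add: orthonormal_def)
  moreover have "u 0 i = (1 / of_real (nrm 0)) * Matrix.vec_index v i" for i
    by (simp add: u_def hd)
  ultimately show ?thesis by (rule that)
qed

text \<open>The characteristic polynomial has degree \<open>n > 0\<close>, hence a complex
  root.\<close>

lemma exists_eigenvector:
  fixes H :: "nat \<Rightarrow> nat \<Rightarrow> complex"
  assumes "n > 0"
  obtains v e where "v \<in> carrier_vec n" "v \<noteq> 0\<^sub>v n"
    "\<And>i. i < n \<Longrightarrow> (\<Sum>j<n. H i j * Matrix.vec_index v j) = e * Matrix.vec_index v i"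
proof -
  define A where "A = Matrix.mat n n (\<lambda>(i, j). H i j)"
  have A: "A \<in> carrier_mat n n" by (simp add: A_def)
  have "degree (char_poly A) = n" using degree_monic_char_poly[OF A] by simp
  with assms have "\<not> constant (poly (char_poly A))" by (simp add: constant_degree)
  then obtain e where "poly (char_poly A) e = 0"
    using fundamental_theorem_of_algebra by blast
  then have "eigenvalue A e" using eigenvalue_root_char_poly[OF A] by simp
  then obtain v where v: "v \<in> carrier_vec n" "v \<noteq> 0\<^sub>v n" "A *\<^sub>v v = e \<cdot>\<^sub>v v"
    using A by (auto simp: eigenvalue_def eigenvector_def)
  have "(\<Sum>j<n. H i j * Matrix.vec_index v j) = e * Matrix.vec_index v i" if "i < n" for i
  proof -
    have "Matrix.vec_index (A *\<^sub>v v) i = Matrix.vec_index (e \<cdot>\<^sub>v v) i" using v(3) by simp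
    then show ?thesis using that v(1) by (auto simp: A_def scalar_prod_def lessThan_atLeast0)
  qed
  then show ?thesis using v by (intro that)
qed

text \<open>Spectral theorem by induction on the dimension: split off a unit eigenvector and
  diagonalize the form on its orthogonal complement. Hermitian symmetry ensures that the two parts
  do not interact.\<close>

lemma hermitian_diagonalizable:
  assumes "hermitian n H"
  shows "\<exists>u e. orthonormal n u \<and> (\<forall>a<n. \<forall>b<n. sesq n H (u a) (u b) = of_bool (a = b) * e a)"
  using assms
proof (induction n arbitrary: H)
  case 0
  then show ?case by (auto simp: orthonormal_def)
next
  case (Suc n)
  obtain v e where v: "v \<in> carrier_vec (Suc n)" "v \<noteq> 0\<^sub>v (Suc n)"
    and ev: "\<And>i. i < Suc n \<Longrightarrow> (\<Sum>j<Suc n. H i j * Matrix.vec_index v j) = e * Matrix.vec_index v i"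
    using exists_eigenvector[of "Suc n" H] by blast
  obtain w c where w: "orthonormal (Suc n) w"
    and wv: "\<And>i. i < Suc n \<Longrightarrow> w 0 i = c * Matrix.vec_index v i"
    using exists_orthonormal_extension[OF v] by blast
  have Hw: "(\<Sum>j<Suc n. H i j * w 0 j) = e * w 0 i" if "i < Suc n" for i
  proof -
    have "(\<Sum>j<Suc n. H i j * w 0 j) = (\<Sum>j<Suc n. c * (H i j * Matrix.vec_index v j))"
      by (intro sum.cong) (auto simp: wv)
    also have "\<dots> = e * w 0 i"
      using ev[OF that] wv[OF that] by (simp only: flip: sum_distrib_left) simp
    finally show ?thesis .
  qed
  have form0: "sesq (Suc n) H f (w 0) = e * cinner (Suc n) f (w 0)" for f
  proof -
    have "sesq (Suc n) H f (w 0) = (\<Sum>i<Suc n. cnj (f i) * (\<Sum>j<Suc n. H i j * w 0 j))"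
      unfolding sesq_def by (simp only: sum_distrib_left mult.assoc)
    also have "\<dots> = (\<Sum>i<Suc n. cnj (f i) * (e * w 0 i))"
      by (intro sum.cong refl) (simp only: Hw lessThan_iff)
    finally show ?thesis by (simp only: cinner_def sum_distrib_left mult_ac)
  qed
  \<comment> \<open>The compression of \<open>H\<close> to the span of the basis vectors other than
    the eigenvector \<open>w 0\<close>.\<close>
  define K where "K a b = sesq (Suc n) H (w (Suc a)) (w (Suc b))" for a b
  have "hermitian n K"
    using sesq_cnj[OF Suc.prems] by (simp add: hermitian_def K_def)
  then obtain u' e' where u': "orthonormal n u'"
    and diag: "\<And>a b. a < n \<Longrightarrow> b < n \<Longrightarrow> sesq n K (u' a) (u' b) = of_bool (a = b) * e' a"
    using Suc.IH by blast
  \<comment> \<open>The eigenvector comes first; the basis from the induction hypothesis consists of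
    coordinate vectors with respect to \<open>w (Suc k)\<close> and is mapped back to the full
    space.\<close>
  define u where "u = case_nat (w 0) (\<lambda>a i. \<Sum>k<n. u' a k * w (Suc k) i)"
  have u0: "u 0 = w 0" and uS: "u (Suc a) = (\<lambda>i. \<Sum>k<n. u' a k * w (Suc k) i)" for a
    by (simp_all add: u_def)
  have o: "cinner (Suc n) (w a) (w b) = of_bool (a = b)" if "a < Suc n" "b < Suc n" for a b
    using w that by (simp add: orthonormal_def)
  have cSS: "cinner (Suc n) (u (Suc a)) (u (Suc b)) = of_bool (a = b)" if "a < n" "b < n" for a b
  proof -
    have "cinner (Suc n) (u (Suc a)) (u (Suc b)) = sesq n (\<lambda>i j. of_bool (i = j)) (u' a) (u' b)"
      unfolding uS cinner_linear_combination sesq_def by (intro sum.cong refl) (simp add: o)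
    then show ?thesis using u' that by (simp add: sesq_identity orthonormal_def)
  qed
  have hSS: "sesq (Suc n) H (u (Suc a)) (u (Suc b)) = of_bool (a = b) * e' a" if "a < n" "b < n" for a b
  proof -
    have "sesq (Suc n) H (u (Suc a)) (u (Suc b)) = sesq n K (u' a) (u' b)"
      unfolding uS sesq_linear_combination K_def sesq_def[where n = n] ..
    then show ?thesis using diag that by simp
  qed
  \<comment> \<open>The single vector \<open>w 0\<close> is treated as a linear combination with
    \<open>Suc 0\<close> terms.\<close>
  have cS0: "cinner (Suc n) (u (Suc a)) (u 0) = 0" for a
    using cinner_linear_combination[of "Suc n" "u' a" "\<lambda>k. w (Suc k)" n "\<lambda>_. 1" "\<lambda>_. w 0" "Suc 0"]
    by (simp add: u0 uS o lessThan_Suc)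
  have c0S: "cinner (Suc n) (u 0) (u (Suc a)) = 0" for a
    using cinner_linear_combination[of "Suc n" "\<lambda>_. 1" "\<lambda>_. w 0" "Suc 0" "u' a" "\<lambda>k. w (Suc k)" n]
    by (simp add: u0 uS o lessThan_Suc)
  have hS0: "sesq (Suc n) H (u (Suc a)) (u 0) = 0" for a
    using form0[of "u (Suc a)"] cS0[of a] by (simp add: u0)
  have h0S: "sesq (Suc n) H (u 0) (u (Suc a)) = 0" for a
    using sesq_cnj[OF Suc.prems, of "u (Suc a)" "u 0"] hS0[of a] by simp
  have c00: "cinner (Suc n) (u 0) (u 0) = 1"
    by (simp add: u0 o)
  have "orthonormal (Suc n) u"
    unfolding orthonormal_def
  proof (intro allI impI)
    fix a b assume "a < Suc n" "b < Suc n"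
    then show "cinner (Suc n) (u a) (u b) = of_bool (a = b)"
      by (cases a; cases b) (simp_all add: cSS cS0 c0S c00)
  qed
  moreover have "sesq (Suc n) H (u a) (u b) = of_bool (a = b) * (case_nat e e' a)"
    if "a < Suc n" "b < Suc n" for a b
    using that form0[of "u 0"]
    by (cases a; cases b) (simp_all add: hSS hS0 h0S c00 u0[symmetric])
  ultimately show ?case by blast
qed

section \<open>Positive semidefinite forms and the Hilbert-Schmidt inner product\<close>

definition psd_form :: "nat \<Rightarrow> (nat \<Rightarrow> nat \<Rightarrow> complex) \<Rightarrow> bool" where
  "psd_form n H \<longleftrightarrow> hermitian n H \<and> (\<forall>f. 0 \<le> Re (sesq n H f f))"

text \<open>This is the trace of \<open>M\<close> times the adjoint of \<open>N\<close>. Unlike in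
  \<open>cinner\<close>, the second argument is the conjugated one.\<close>

definition hs_inner :: "nat \<Rightarrow> (nat \<Rightarrow> nat \<Rightarrow> complex) \<Rightarrow> (nat \<Rightarrow> nat \<Rightarrow> complex) \<Rightarrow> complex" where
  "hs_inner n M N = (\<Sum>i<n. \<Sum>j<n. M i j * cnj (N i j))"

lemma sesq_cong:
  "(\<And>i. i < n \<Longrightarrow> f i = f' i) \<Longrightarrow> (\<And>i. i < n \<Longrightarrow> g i = g' i) \<Longrightarrow> sesq n H f g = sesq n H f' g'"
  unfolding sesq_def by (auto intro!: sum.cong)

lemma sum_of_bool_delta:
  fixes f :: "nat \<Rightarrow> complex"
  assumes "i < n"
  shows "(\<Sum>x<n. of_bool (x = i) * f x) = f i" "(\<Sum>x<n. of_bool (i = x) * f x) = f i"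
  using assms by (subst sum.remove[of _ i]; auto intro!: sum.neutral)+

lemma sesq_scale: "sesq n H (\<lambda>i. c * f i) (\<lambda>i. d * g i) = cnj c * d * sesq n H f g"
  unfolding sesq_def by (simp add: sum_distrib_left mult_ac)

text \<open>The new form at coefficients \<open>f\<close> is the old one at the combination of the
  \<open>w a\<close> with these coefficients. The size may change from \<open>n\<close> to
  \<open>k\<close>, so operators of both players can become matrices of the same size.\<close>

lemma psd_form_congruence:
  assumes "psd_form n H"
  shows "psd_form k (\<lambda>a b. sesq n H (w a) (w b))"
proof -
  have herm: "hermitian n H" using assms by (simp add: psd_form_def)
  have "sesq k (\<lambda>a b. sesq n H (w a) (w b)) f f
      = sesq n H (\<lambda>i. \<Sum>a<k. f a * w a i) (\<lambda>i. \<Sum>a<k. f a * w a i)" for f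
    unfolding sesq_linear_combination by (simp add: sesq_def)
  moreover have "hermitian k (\<lambda>a b. sesq n H (w a) (w b))"
    unfolding hermitian_def by (simp add: sesq_cnj[OF herm])
  ultimately show ?thesis
    using assms by (simp add: psd_form_def)
qed

lemma psd_form_cnj:
  assumes "psd_form n H"
  shows "psd_form n (\<lambda>i j. cnj (H i j))"
proof -
  have "sesq n (\<lambda>i j. cnj (H i j)) f f = cnj (sesq n H (\<lambda>i. cnj (f i)) (\<lambda>i. cnj (f i)))" for f
    by (simp add: sesq_def)
  moreover have "hermitian n (\<lambda>i j. cnj (H i j))"
    using assms unfolding psd_form_def hermitian_def by metis
  ultimately show ?thesis using assms by (simp add: psd_form_def)
qed

text \<open>An entry of \<open>H\<close> is the form at two standard basis vectors; expanding these
  in an eigenbasis gives the sum. The eigenvalues are values of the form, hence real and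
  nonnegative.\<close>

lemma psd_form_spectral:
  assumes "psd_form n H"
  obtains u and e :: "nat \<Rightarrow> real" where "\<And>a. a < n \<Longrightarrow> 0 \<le> e a"
    "\<And>i j. i < n \<Longrightarrow> j < n \<Longrightarrow> H i j = (\<Sum>a<n. of_real (e a) * u a i * cnj (u a j))"
proof -
  have herm: "hermitian n H" and nonneg: "\<And>f. 0 \<le> Re (sesq n H f f)"
    using assms by (auto simp: psd_form_def)
  obtain u d where u: "orthonormal n u"
    and diag: "\<And>a b. a < n \<Longrightarrow> b < n \<Longrightarrow> sesq n H (u a) (u b) = of_bool (a = b) * d a"
    using hermitian_diagonalizable[OF herm] by blast
  define e where "e a = Re (sesq n H (u a) (u a))" for a
  have real: "sesq n H (u a) (u a) = of_real (e a)" for a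
    using sesq_cnj[OF herm, of "u a" "u a"] by (simp add: e_def complex_eq_iff)
  have diag': "sesq n H (u a) (u b) = of_bool (a = b) * of_real (e a)" if "a < n" "b < n" for a b
    using diag[OF that] diag[OF that(1) that(1)] real[of a] by simp
  have "H i j = (\<Sum>a<n. of_real (e a) * u a i * cnj (u a j))" if "i < n" "j < n" for i j
  proof -
    have unit: "of_bool (x = k) = (\<Sum>a<n. cnj (u a k) * u a x)" if "x < n" "k < n" for x k
      using orthonormal_complete[OF u that] by (simp add: mult.commute)
    have "H i j = sesq n H (\<lambda>x. of_bool (x = i)) (\<lambda>x. of_bool (x = j))"
    proof -
      have "sesq n H (\<lambda>x. of_bool (x = i)) (\<lambda>x. of_bool (x = j))
          = (\<Sum>x<n. of_bool (x = i) * (\<Sum>y<n. of_bool (y = j) * H x y))"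
        unfolding sesq_def sum_distrib_left by (intro sum.cong refl) (simp add: of_bool_def)
      then show ?thesis using that by (simp add: sum_of_bool_delta)
    qed
    also have "\<dots> = sesq n H (\<lambda>x. \<Sum>a<n. cnj (u a i) * u a x) (\<lambda>x. \<Sum>a<n. cnj (u a j) * u a x)"
      by (intro sesq_cong unit that)
    also have "\<dots> = (\<Sum>a<n. \<Sum>b<n. u a i * sesq n H (u a) (u b) * cnj (u b j))"
      by (simp add: sesq_linear_combination)
    also have "\<dots> = (\<Sum>a<n. \<Sum>b<n. of_bool (a = b) * (of_real (e a) * u a i * cnj (u b j)))"
      by (intro sum.cong refl) (simp add: diag')
    also have "\<dots> = (\<Sum>a<n. of_real (e a) * u a i * cnj (u a j))"
      by (intro sum.cong refl) (simp add: sum_of_bool_delta)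
    finally show ?thesis .
  qed
  moreover have "0 \<le> e a" for a using nonneg by (simp add: e_def)
  ultimately show ?thesis by (intro that)
qed

text \<open>Inserting the spectral decomposition of \<open>R\<close> turns the inner product into a
  combination, with the eigenvalues as weights, of values of the form \<open>P\<close>.\<close>

lemma hs_inner_psd_nonneg:
  assumes "psd_form n P" "psd_form n R"
  shows "0 \<le> Re (hs_inner n P R)"
proof -
  obtain u and e :: "nat \<Rightarrow> real" where e: "\<And>a. a < n \<Longrightarrow> 0 \<le> e a"
    and R: "\<And>i j. i < n \<Longrightarrow> j < n \<Longrightarrow> R i j = (\<Sum>a<n. of_real (e a) * u a i * cnj (u a j))"
    using psd_form_spectral[OF assms(2)] by metis
  have "hs_inner n P R = (\<Sum>i<n. \<Sum>j<n. \<Sum>a<n. of_real (e a) * (cnj (u a i) * P i j * u a j))"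
    unfolding hs_inner_def
    by (intro sum.cong refl) (simp add: R sum_distrib_left mult_ac)
  also have "\<dots> = (\<Sum>i<n. \<Sum>a<n. \<Sum>j<n. of_real (e a) * (cnj (u a i) * P i j * u a j))"
    by (intro sum.cong refl sum.swap)
  also have "\<dots> = (\<Sum>a<n. \<Sum>i<n. \<Sum>j<n. of_real (e a) * (cnj (u a i) * P i j * u a j))"
    by (rule sum.swap)
  also have "\<dots> = (\<Sum>a<n. of_real (e a) * sesq n P (u a) (u a))"
    by (simp add: sesq_def sum_distrib_left)
  also have "Re \<dots> = (\<Sum>a<n. e a * Re (sesq n P (u a) (u a)))"
    by simp
  also have "\<dots> \<ge> 0"
    using assms(1) e by (intro sum_nonneg mult_nonneg_nonneg) (auto simp: psd_form_def)
  finally show ?thesis .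
qed

lemma hs_inner_cnj: "cnj (hs_inner n M N) = hs_inner n N M"
  by (simp add: hs_inner_def mult.commute)

lemma hs_inner_sum:
  "hs_inner n (\<lambda>i j. \<Sum>k\<in>A. of_real (c k) * M k i j) (\<lambda>i j. \<Sum>l\<in>B. of_real (d l) * N l i j) =
     (\<Sum>k\<in>A. \<Sum>l\<in>B. of_real (c k * d l) * hs_inner n (M k) (N l))"
proof -
  have "hs_inner n (\<lambda>i j. \<Sum>k\<in>A. of_real (c k) * M k i j) (\<lambda>i j. \<Sum>l\<in>B. of_real (d l) * N l i j)
      = (\<Sum>i<n. \<Sum>j<n. \<Sum>k\<in>A. \<Sum>l\<in>B. of_real (c k * d l) * (M k i j * cnj (N l i j)))"
    unfolding hs_inner_def cnj_sum sum_product
    by (intro sum.cong refl) (simp add: mult_ac)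
  also have "\<dots> = (\<Sum>k\<in>A. \<Sum>l\<in>B. \<Sum>i<n. \<Sum>j<n. of_real (c k * d l) * (M k i j * cnj (N l i j)))"
    by (simp only: sum.swap[of _ "{..<n}" A] sum.swap[of _ "{..<n}" B])
  also have "\<dots> = (\<Sum>k\<in>A. \<Sum>l\<in>B. of_real (c k * d l) * hs_inner n (M k) (N l))"
    by (simp only: hs_inner_def sum_distrib_left)
  finally show ?thesis .
qed

lemma hs_inner_self_nonneg: "0 \<le> Re (hs_inner n M M)"
  by (auto simp: hs_inner_def intro!: sum_nonneg add_nonneg_nonneg)

text \<open>Take for \<open>u\<close> an eigenbasis of \<open>K\<close> times its adjoint and for
  \<open>l a\<close> the coordinates of the columns of \<open>K\<close> along \<open>u a\<close>.
  The \<open>l a\<close> are not normalized, so vanishing Schmidt coefficients need no separate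
  treatment. The fourth power makes the square root of the norm of \<open>l a\<close> available as
  \<open>r a\<close>.\<close>

lemma schmidt_decomposition:
  fixes K :: "nat \<Rightarrow> nat \<Rightarrow> complex"
  obtains u l and r :: "nat \<Rightarrow> real" where "orthonormal n u"
    "\<And>i x. i < n \<Longrightarrow> K i x = (\<Sum>a<n. u a i * l a x)"
    "\<And>a b. a < n \<Longrightarrow> b < n \<Longrightarrow> cinner m (l a) (l b) = of_bool (a = b) * of_real (r a ^ 4)"
proof -
  define Z where "Z i j = (\<Sum>x<m. K i x * cnj (K j x))" for i j
  have "hermitian n Z" by (simp add: hermitian_def Z_def mult.commute)
  then obtain u d where u: "orthonormal n u"
    and diag: "\<And>a b. a < n \<Longrightarrow> b < n \<Longrightarrow> sesq n Z (u a) (u b) = of_bool (a = b) * d a"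
    using hermitian_diagonalizable by blast
  define l where "l a x = cinner n (u a) (\<lambda>i. K i x)" for a x
  define q where "q a = (\<Sum>x<m. (cmod (l a x))\<^sup>2)" for a
  define r where "r a = sqrt (sqrt (q a))" for a
  have q: "0 \<le> q a" for a by (simp add: q_def sum_nonneg)
  have "K i x = (\<Sum>a<n. u a i * l a x)" if "i < n" for i x
  proof -
    have "(\<Sum>a<n. u a i * l a x) = (\<Sum>j<n. \<Sum>a<n. u a i * cnj (u a j) * K j x)"
      unfolding l_def cinner_def sum_distrib_left by (subst sum.swap) (simp add: mult_ac)
    also have "\<dots> = (\<Sum>j<n. of_bool (i = j) * K j x)"
      using orthonormal_complete[OF u that] by (intro sum.cong refl) (simp flip: sum_distrib_right)
    also have "\<dots> = K i x"
      using that by (simp add: sum_of_bool_delta)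
    finally show ?thesis ..
  qed
  moreover have self: "cinner m (l a) (l a) = of_real (r a ^ 4)" for a
  proof -
    have "cinner m (l a) (l a) = of_real (q a)"
      unfolding cinner_def q_def of_real_sum
      by (intro sum.cong refl) (simp only: complex_norm_square mult.commute)
    moreover have "r a ^ 4 = q a"
      using q[of a] power_mult[of "r a" 2 2] by (simp add: r_def)
    ultimately show ?thesis by simp
  qed
  moreover have "cinner m (l a) (l b) = of_bool (a = b) * of_real (r a ^ 4)" if "a < n" "b < n" for a b
  proof -
    \<comment> \<open>The order of \<open>a\<close> and \<open>b\<close> is reversed in the form
      because \<open>l a\<close> depends conjugate-linearly on \<open>u a\<close>.\<close>
    have "cinner m (l a) (l b) = (\<Sum>x<m. \<Sum>i<n. \<Sum>j<n. cnj (u b j) * (K j x * cnj (K i x)) * u a i)"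
      unfolding cinner_def l_def cnj_sum sum_product
      by (intro sum.cong refl) simp
    also have "\<dots> = (\<Sum>i<n. \<Sum>j<n. \<Sum>x<m. cnj (u b j) * (K j x * cnj (K i x)) * u a i)"
      by (simp only: sum.swap[of _ "{..<m}" "{..<n}"])
    also have "\<dots> = sesq n Z (u b) (u a)"
      unfolding sesq_def Z_def sum_distrib_left sum_distrib_right by (rule sum.swap)
    finally have "cinner m (l a) (l b) = sesq n Z (u b) (u a)" .
    then show ?thesis using diag that self[of a] by (cases "a = b") auto
  qed
  ultimately show ?thesis using u by (intro that)
qed

section \<open>Doubly nonnegative matrices\<close>

text \<open>The real part makes this a real matrix by definition.\<close>

definition gram :: "nat \<Rightarrow> ('k \<Rightarrow> nat \<Rightarrow> nat \<Rightarrow> complex) \<Rightarrow> real ^ ('k::finite) ^ 'k" where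
  "gram n M = (\<chi> k l. Re (hs_inner n (M k) (M l)))"

text \<open>The quadratic form at \<open>v\<close> is the squared Hilbert-Schmidt norm of the
  combination of the \<open>M k\<close> with coefficients \<open>v $ k\<close>; nonnegativity of the
  entries is \<open>hs_inner_psd_nonneg\<close>.\<close>

lemma gram_DNN:
  assumes "\<And>k. psd_form n (M k)"
  shows "gram n M \<in> DNN"
proof -
  have "Re (hs_inner n (M k) (M l)) = Re (hs_inner n (M l) (M k))" for k l
    using arg_cong[OF hs_inner_cnj[of n "M k" "M l"], of Re] by simp
  then have "Finite_Cartesian_Product.transpose (gram n M) = gram n M"
    by (simp add: gram_def Finite_Cartesian_Product.transpose_def)
  moreover have "0 \<le> v \<bullet> (gram n M *v v)" for v
  proof -
    have "v \<bullet> (gram n M *v v)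
        = Re (\<Sum>k\<in>UNIV. \<Sum>l\<in>UNIV. of_real (v $ k * v $ l) * hs_inner n (M k) (M l))"
      by (simp add: inner_vec_def matrix_vector_mult_def gram_def sum_distrib_left mult_ac)
    also have "\<dots> = Re (hs_inner n (\<lambda>i j. \<Sum>k\<in>UNIV. of_real (v $ k) * M k i j)
        (\<lambda>i j. \<Sum>k\<in>UNIV. of_real (v $ k) * M k i j))"
      by (simp only: hs_inner_sum)
    finally show ?thesis by (simp add: hs_inner_self_nonneg)
  qed
  ultimately show ?thesis
    using assms by (auto simp: DNN_def gram_def intro: hs_inner_psd_nonneg)
qed

text \<open>By bilinearity a block sum depends only on the totals of the two blocks, so families
  with a common total have all block sums equal.\<close>

lemma block_sum_gram:
  "block_sum i j (gram n M) =
     Re (hs_inner n (\<lambda>x y. \<Sum>k\<in>block i. M k x y) (\<lambda>x y. \<Sum>k\<in>block j. M k x y))"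
  using hs_inner_sum[where n = n and A = "block i" and B = "block j" and c = "\<lambda>_. 1" and d = "\<lambda>_. 1"
    and M = M and N = M]
  by (simp add: block_sum_def gram_def)

lemma sum_UNIV_Plus:
  fixes f :: "'x::finite + 'y::finite \<Rightarrow> 'c::comm_monoid_add"
  shows "(\<Sum>k\<in>UNIV. f k) = (\<Sum>x\<in>UNIV. f (Inl x)) + (\<Sum>y\<in>UNIV. f (Inr y))"
  by (simp add: sum.Plus flip: UNIV_Plus_UNIV)

lemma sum_UNIV_prod:
  fixes f :: "'x::finite \<times> 'y::finite \<Rightarrow> 'c::comm_monoid_add"
  shows "(\<Sum>k\<in>UNIV. f k) = (\<Sum>x\<in>UNIV. \<Sum>y\<in>UNIV. f (x, y))"
  by (simp add: sum.cartesian_product flip: UNIV_Times_UNIV)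

lemma sum_block_Inl [simp]: "(\<Sum>k\<in>block (Inl s). f k) = (\<Sum>a\<in>UNIV. f (Inl (s, a)))"
  by (simp add: sum.reindex inj_on_def)

lemma sum_block_Inr [simp]: "(\<Sum>k\<in>block (Inr t). f k) = (\<Sum>b\<in>UNIV. f (Inr (t, b)))"
  by (simp add: sum.reindex inj_on_def)

section \<open>From feasible matrices to nonsignaling correlations\<close>

definition off_diagonal :: "real ^ ('s::finite \<times> 'a::finite + 't::finite \<times> 'b::finite) ^ ('s \<times> 'a + 't \<times> 'b) \<Rightarrow>
    ('s, 't, 'a, 'b) correlation" where
  "off_diagonal X a b s t = X $ Inl (s, a) $ Inr (t, b)"

lemma DNN_symmetric: "X \<in> DNN \<Longrightarrow> X $ k $ l = X $ l $ k"
  unfolding DNN_def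
  by (metis (mono_tags, lifting) Finite_Cartesian_Product.transpose_def mem_Collect_eq vec_lambda_beta)

text \<open>By symmetry of \<open>X\<close> the two off-diagonal blocks of \<open>sym_cost\<close>
  contribute equally, which cancels the factor 1/2.\<close>

lemma trace_sym_cost:
  assumes "X \<in> DNN"
  shows "Determinants.trace (sym_cost \<pi> V ** X) = winning_prob \<pi> V (off_diagonal X)"
proof -
  let ?c = "\<lambda>s a t b. \<pi> s t * of_bool (V a b s t) * X $ Inl (s, a) $ Inr (t, b)"
  have sym: "X $ Inr y $ Inl x = X $ Inl x $ Inr y" for x y
    by (rule DNN_symmetric[OF assms])
  have "Determinants.trace (sym_cost \<pi> V ** X)
      = (\<Sum>s\<in>UNIV. \<Sum>a\<in>UNIV. \<Sum>t\<in>UNIV. \<Sum>b\<in>UNIV. ?c s a t b / 2)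
      + (\<Sum>t\<in>UNIV. \<Sum>b\<in>UNIV. \<Sum>s\<in>UNIV. \<Sum>a\<in>UNIV. ?c s a t b / 2)"
    by (simp add: Determinants.trace_def matrix_matrix_mult_def sum_UNIV_Plus sum_UNIV_prod
        sym_cost_def cost_def Finite_Cartesian_Product.transpose_def sym)
  also have "(\<Sum>t\<in>UNIV. \<Sum>b\<in>UNIV. \<Sum>s\<in>UNIV. \<Sum>a\<in>UNIV. ?c s a t b / 2)
      = (\<Sum>s\<in>UNIV. \<Sum>a\<in>UNIV. \<Sum>t\<in>UNIV. \<Sum>b\<in>UNIV. ?c s a t b / 2)"
    \<comment> \<open>Question and answer of each player are packed into a pair, so that one
      exchange moves both.\<close>
    using sum.swap[of "\<lambda>y x. ?c (fst x) (snd x) (fst y) (snd y) / 2" UNIV UNIV]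
    by (simp add: sum_UNIV_prod)
  also have "(\<Sum>s\<in>UNIV. \<Sum>a\<in>UNIV. \<Sum>t\<in>UNIV. \<Sum>b\<in>UNIV. ?c s a t b / 2) + \<dots>
      = (\<Sum>s\<in>UNIV. \<Sum>a\<in>UNIV. \<Sum>t\<in>UNIV. \<Sum>b\<in>UNIV. ?c s a t b)"
    by (simp add: mult.assoc flip: sum.distrib)
  also have "\<dots> = (\<Sum>s\<in>UNIV. \<Sum>t\<in>UNIV. \<Sum>a\<in>UNIV. \<Sum>b\<in>UNIV. ?c s a t b)"
    by (intro sum.cong refl sum.swap)
  also have "\<dots> = winning_prob \<pi> V (off_diagonal X)"
    by (simp only: winning_prob_def off_diagonal_def sum_distrib_left mult.assoc)
  finally show ?thesis .
qed

text \<open>Along the line from \<open>v\<close> in direction \<open>w = X *v v\<close> the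
  quadratic form starts at zero with slope twice the squared norm of \<open>w\<close>, so it would
  become negative on one side unless \<open>w = 0\<close>. The step length is divided by
  \<open>c + 1\<close> because \<open>c\<close> may be zero.\<close>

lemma psd_kernel:
  fixes X :: "real ^ 'n ^ 'n::finite"
  assumes sym: "Finite_Cartesian_Product.transpose X = X" and psd: "\<And>v. 0 \<le> v \<bullet> (X *v v)"
    and "v \<bullet> (X *v v) = 0"
  shows "X *v v = 0"
proof -
  define w where "w = X *v v"
  define b where "b = w \<bullet> w"
  define c where "c = w \<bullet> (X *v w)"
  have c: "0 \<le> c" unfolding c_def by (rule psd)
  have "v \<bullet> (X *v w) = (X *v v) \<bullet> w"
    by (metis dot_lmul_matrix sym transpose_matrix_vector)
  then have vw: "v \<bullet> (X *v w) = b" by (simp add: b_def w_def)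
  have wv: "w \<bullet> (X *v v) = b" by (simp add: b_def w_def)
  \<comment> \<open>a step against \<open>w\<close> at which the quadratic \<open>2 * t * b + t\<^sup>2 * c\<close> is negative unless \<open>b = 0\<close>\<close>
  define t where "t = - b / (c + 1)"
  have "0 \<le> (v + t *\<^sub>R w) \<bullet> (X *v (v + t *\<^sub>R w))" by (rule psd)
  also have "\<dots> = 2 * t * b + t\<^sup>2 * c"
    using assms(3) vw wv
    by (simp add: matrix_vector_right_distrib matrix_vector_mult_scaleR inner_add_left inner_add_right
        power2_eq_square c_def algebra_simps)
  also have "\<dots> = - (b\<^sup>2 * (c + 2)) / (c + 1)\<^sup>2"
    using c unfolding t_def by (simp add: divide_simps power2_eq_square) (simp add: algebra_simps)
  finally have "b\<^sup>2 * (c + 2) \<le> 0"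
    using c by (simp add: divide_simps split: if_splits)
  then have "b = 0"
    using c by (simp add: mult_le_0_iff)
  then show ?thesis by (simp add: b_def w_def)
qed

text \<open>This is row \<open>k\<close> of the statement that the difference of two block
  indicators lies in the kernel of \<open>X\<close>. Rows of either player are allowed, which yields
  both nonsignaling conditions.\<close>

lemma block_row_sum_eq:
  fixes X :: "real ^ ('s::finite \<times> 'a::finite + 't::finite \<times> 'b::finite) ^ ('s \<times> 'a + 't \<times> 'b)"
  assumes X: "X \<in> DNN" and one: "\<And>i j. block_sum i j X = 1"
  shows "(\<Sum>l\<in>block i. X $ k $ l) = (\<Sum>l\<in>block j. X $ k $ l)"
proof -
  define e :: "'s + 't \<Rightarrow> real ^ ('s \<times> 'a + 't \<times> 'b)" where "e i = (\<chi> k. of_bool (k \<in> block i))" for i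
  have row: "(X *v e i) $ k = (\<Sum>l\<in>block i. X $ k $ l)" for i k
    by (simp add: e_def matrix_vector_mult_def of_bool_def if_distrib sum.If_cases cong: if_cong)
  have "e i \<bullet> (X *v e j) = (\<Sum>k\<in>UNIV. of_bool (k \<in> block i) * (X *v e j) $ k)" for i j
    by (simp add: e_def inner_vec_def)
  then have form: "e i \<bullet> (X *v e j) = 1" for i j
    using one[of i j]
    by (simp add: row block_sum_def of_bool_def if_distrib if_distribR sum.If_cases cong: if_cong)
  have "X *v (e i - e j) = 0"
    using X by (intro psd_kernel) (auto simp: DNN_def matrix_vector_mult_diff_distrib inner_diff_left
        inner_diff_right form)
  then have "(X *v e i) $ k = (X *v e j) $ k"
    by (simp add: matrix_vector_mult_diff_distrib)
  then show ?thesis by (simp add: row)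
qed

lemma off_diagonal_nonsignaling:
  assumes X: "X \<in> DNN" and one: "\<And>i j. block_sum i j X = 1"
  shows "off_diagonal X \<in> nonsignaling_correlations"
proof -
  have "(\<Sum>a\<in>UNIV. \<Sum>b\<in>UNIV. off_diagonal X a b s t) = 1" for s t
    using one[of "Inl s" "Inr t"] by (simp add: block_sum_def off_diagonal_def del: block.simps)
  moreover have "(\<Sum>b\<in>UNIV. off_diagonal X a b s t) = (\<Sum>b\<in>UNIV. off_diagonal X a b s t')" for a s t t'
    using block_row_sum_eq[OF X one, where i = "Inr t" and j = "Inr t'" and k = "Inl (s, a)"] by (simp add: off_diagonal_def del: block.simps)
  \<comment> \<open>Here the row belongs to the second player, and symmetry of \<open>X\<close>
    moves the entries to the block read by \<open>off_diagonal\<close>.\<close>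
  moreover have "(\<Sum>a\<in>UNIV. off_diagonal X a b s t) = (\<Sum>a\<in>UNIV. off_diagonal X a b s' t)" for b t s s'
    using block_row_sum_eq[OF X one, where i = "Inl s" and j = "Inl s'" and k = "Inr (t, b)"]
    by (simp add: off_diagonal_def DNN_symmetric[OF X, of "Inr (t, b)"] del: block.simps)
  moreover have "0 \<le> off_diagonal X a b s t" for a b s t
    using X by (simp add: off_diagonal_def DNN_def)
  ultimately show ?thesis
    unfolding nonsignaling_correlations_def correlations_def by blast
qed

text \<open>Provides the upper bounds without which comparing real suprema is impossible.\<close>

lemma winning_prob_le_1:
  assumes "prob_distribution \<pi>" "p \<in> correlations"
  shows "winning_prob \<pi> V p \<le> 1"
proof -
  have "(\<Sum>a\<in>UNIV. \<Sum>b\<in>UNIV. of_bool (V a b s t) * p a b s t) \<le> (\<Sum>a\<in>UNIV. \<Sum>b\<in>UNIV. p a b s t)" for s t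
    using assms(2) by (intro sum_mono) (auto simp: correlations_def of_bool_def)
  then have "winning_prob \<pi> V p \<le> (\<Sum>s\<in>UNIV. \<Sum>t\<in>UNIV. \<pi> s t * 1)"
    using assms unfolding winning_prob_def
    by (intro sum_mono mult_left_mono) (auto simp: correlations_def prob_distribution_def)
  then show ?thesis using assms(1) by (simp add: prob_distribution_def)
qed

section \<open>Quantum correlations\<close>

lemma index_mat_adjoint:
  "i < dim_col M \<Longrightarrow> j < dim_row M \<Longrightarrow> mat_adjoint M $$ (i, j) = conjugate (M $$ (j, i))"
  by (simp add: mat_adjoint_def mat_of_rows_index)

lemma psd_form_of_psd_operator:
  assumes "psd_operator n M"
  shows "psd_form n (\<lambda>i j. M $$ (i, j))"
proof -
  have M: "M \<in> carrier_mat n n" and adj: "mat_adjoint M = M"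
    and pos: "\<And>v. v \<in> carrier_vec n \<Longrightarrow> 0 \<le> Re ((M *\<^sub>v v) \<bullet>c v)"
    using assms by (auto simp: psd_operator_def)
  have "M $$ (j, i) = cnj (M $$ (i, j))" if "i < n" "j < n" for i j
    using index_mat_adjoint[of j M i] that M by (simp add: adj)
  moreover have "0 \<le> Re (sesq n (\<lambda>i j. M $$ (i, j)) f f)" for f
  proof -
    have "(M *\<^sub>v Matrix.vec n f) \<bullet>c Matrix.vec n f = (\<Sum>i<n. (\<Sum>j<n. M $$ (i, j) * f j) * cnj (f i))"
      using M by (simp add: scalar_prod_def lessThan_atLeast0)
    also have "\<dots> = sesq n (\<lambda>i j. M $$ (i, j)) f f"
      by (simp add: sesq_def sum_distrib_left sum_distrib_right mult_ac)
    finally show ?thesis using pos[of "Matrix.vec n f"] by simp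
  qed
  ultimately show ?thesis
    unfolding psd_form_def hermitian_def by blast
qed

lemma sum_lessThan_mult:
  fixes f :: "nat \<Rightarrow> 'c::comm_monoid_add"
  shows "(\<Sum>k<n * m. f k) = (\<Sum>i<n. \<Sum>x<m. f (i * m + x))"
proof -
  have "sum f {i * m..<i * m + m} = (\<Sum>x<m. f (i * m + x))" for i
    using sum.shift_bounds_nat_ivl[of f 0 "i * m" m] by (simp add: lessThan_atLeast0 add.commute)
  then show ?thesis by (simp flip: sum.nat_group)
qed

lemma sum_swap_pairs:
  "(\<Sum>i\<in>A. \<Sum>j\<in>B. \<Sum>k\<in>C. \<Sum>l\<in>D. f i j k l) = (\<Sum>k\<in>C. \<Sum>l\<in>D. \<Sum>i\<in>A. \<Sum>j\<in>B. f i j k l)"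
  by (simp only: sum.swap[of _ A C] sum.swap[of _ B C] sum.swap[of _ A D] sum.swap[of _ B D])

text \<open>Dividing an index by \<open>m\<close> with remainder reshapes \<open>\<psi>\<close> into
  an \<open>n\<close> by \<open>m\<close> coefficient matrix \<open>K\<close>; the first operator
  then acts on the row index and the second inside the rows.\<close>

lemma kronecker_quadratic_form:
  assumes X: "X \<in> carrier_mat n n" and Y: "Y \<in> carrier_mat m m" and \<psi>: "\<psi> \<in> carrier_vec (n * m)"
  defines "K \<equiv> \<lambda>i x. Matrix.vec_index \<psi> (i * m + x)"
  shows "(kronecker X Y *\<^sub>v \<psi>) \<bullet>c \<psi> =
    (\<Sum>i<n. \<Sum>j<n. X $$ (i, j) * sesq m (\<lambda>x y. Y $$ (x, y)) (K i) (K j))"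
proof -
  have bound: "i * m + x < n * m" if "i < n" "x < m" for i x
  proof -
    have "i * m + x < Suc i * m" using that by simp
    also have "\<dots> \<le> n * m" using that by (intro mult_le_mono1) simp
    finally show ?thesis .
  qed
  have entry: "kronecker X Y $$ (i * m + x, j * m + y) = X $$ (i, j) * Y $$ (x, y)"
    if "i < n" "j < n" "x < m" "y < m" for i j x y
    using that X Y bound[of i x] bound[of j y] by (auto simp: kronecker_def)
  have "(kronecker X Y *\<^sub>v \<psi>) \<bullet>c \<psi>
      = (\<Sum>k<n * m. (\<Sum>l<n * m. kronecker X Y $$ (k, l) * Matrix.vec_index \<psi> l) * cnj (Matrix.vec_index \<psi> k))"
    using X Y \<psi> by (auto simp: scalar_prod_def lessThan_atLeast0 kronecker_def intro!: sum.cong)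
  also have "\<dots> = (\<Sum>i<n. \<Sum>x<m. \<Sum>j<n. \<Sum>y<m. X $$ (i, j) * (cnj (K i x) * Y $$ (x, y) * K j y))"
    unfolding sum_lessThan_mult sum_distrib_right
    by (intro sum.cong refl) (simp add: entry K_def)
  also have "\<dots> = (\<Sum>i<n. \<Sum>j<n. \<Sum>x<m. \<Sum>y<m. X $$ (i, j) * (cnj (K i x) * Y $$ (x, y) * K j y))"
    by (intro sum.cong refl sum.swap)
  also have "\<dots> = (\<Sum>i<n. \<Sum>j<n. X $$ (i, j) * sesq m (\<lambda>x y. Y $$ (x, y)) (K i) (K j))"
    by (simp only: sesq_def sum_distrib_left)
  finally show ?thesis .
qed

lemma measurement_psd_form: "measurement n M \<Longrightarrow> psd_form n (\<lambda>i j. M a $$ (i, j))"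
  by (simp add: measurement_def psd_form_of_psd_operator)

lemma measurement_carrier: "measurement n M \<Longrightarrow> M a \<in> carrier_mat n n"
  by (simp add: measurement_def psd_operator_def)

lemma sum_sesq_measurement:
  assumes "measurement n M"
  shows "(\<Sum>a\<in>UNIV. sesq n (\<lambda>i j. M a $$ (i, j)) f g) = cinner n f g"
proof -
  have M: "(\<Sum>a\<in>UNIV. M a $$ (i, j)) = of_bool (i = j)" if "i < n" "j < n" for i j
  proof -
    have "Matrix.mat n n (\<lambda>ij. \<Sum>a\<in>UNIV. M a $$ ij) $$ (i, j) = 1\<^sub>m n $$ (i, j)"
      using assms by (simp only: measurement_def)
    then show ?thesis using that by simp
  qed
  have "(\<Sum>a\<in>UNIV. sesq n (\<lambda>i j. M a $$ (i, j)) f g)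
      = (\<Sum>i<n. \<Sum>j<n. \<Sum>a\<in>UNIV. cnj (f i) * M a $$ (i, j) * g j)"
    unfolding sesq_def by (simp only: sum.swap[of _ "{..<n}" UNIV])
  also have "\<dots> = (\<Sum>i<n. \<Sum>j<n. cnj (f i) * of_bool (i = j) * g j)"
    by (intro sum.cong refl) (simp add: M flip: sum_distrib_left sum_distrib_right)
  also have "\<dots> = cinner n f g"
    using sesq_identity[of n f g] by (simp only: sesq_def)
  finally show ?thesis .
qed

text \<open>The factors \<open>r\<close> in \<open>P\<close> and their inverses in \<open>Q\<close>
  cancel in the inner products but balance the totals: with \<open>\<alpha> = \<beta>\<close>, one
  side gives \<open>r \<alpha>\<close> squared times 1, the other \<open>r \<alpha>\<close> to the
  fourth power divided by its square. The conjugation in \<open>Q\<close> undoes the one in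
  \<open>hs_inner\<close>.\<close>

lemma quantum_correlation_DNN:
  fixes p :: "('s::finite, 't::finite, 'a::finite, 'b::finite) correlation"
  assumes "p \<in> quantum_correlations"
  obtains Z where "Z \<in> DNN" "\<And>i j. block_sum i j Z = 1" "off_diagonal Z = p"
proof -
  obtain n m \<psi> and X :: "'s \<Rightarrow> 'a \<Rightarrow> complex mat" and Y :: "'t \<Rightarrow> 'b \<Rightarrow> complex mat"
    where \<psi>: "\<psi> \<in> carrier_vec (n * m)" and X: "\<And>s. measurement n (X s)" and Y: "\<And>t. measurement m (Y t)"
      and p: "\<And>a b s t. complex_of_real (p a b s t) = (kronecker (X s a) (Y t b) *\<^sub>v \<psi>) \<bullet>c \<psi>"
    using assms unfolding quantum_correlations_def by blast
  define K where "K i x = Matrix.vec_index \<psi> (i * m + x)" for i x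
  obtain u l and r :: "nat \<Rightarrow> real" where u: "orthonormal n u"
    and K: "\<And>i x. i < n \<Longrightarrow> K i x = (\<Sum>a<n. u a i * l a x)"
    and l: "\<And>a b. a < n \<Longrightarrow> b < n \<Longrightarrow> cinner m (l a) (l b) = of_bool (a = b) * of_real (r a ^ 4)"
    by (rule schmidt_decomposition[where n = n and K = K and m = m]) (rule that)
  let ?X = "\<lambda>s a i j. X s a $$ (i, j)" and ?Y = "\<lambda>t b x y. Y t b $$ (x, y)"
  define P where "P s a \<alpha> \<beta> = sesq n (?X s a) (\<lambda>i. of_real (r \<alpha>) * u \<alpha> i) (\<lambda>j. of_real (r \<beta>) * u \<beta> j)"
    for s a \<alpha> \<beta>
  \<comment> \<open>Where \<open>r \<alpha> = 0\<close>, the junk value \<open>inverse 0 = 0\<close> is harmless because \<open>l \<alpha>\<close> vanishes.\<close>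
  define Q where "Q t b \<alpha> \<beta> = cnj (sesq m (?Y t b) (\<lambda>x. of_real (inverse (r \<alpha>)) * l \<alpha> x)
      (\<lambda>y. of_real (inverse (r \<beta>)) * l \<beta> y))" for t b \<alpha> \<beta>
  define M where "M k = (case k of Inl (s, a) \<Rightarrow> P s a | Inr (t, b) \<Rightarrow> Q t b)" for k
  define D where "D \<alpha> \<beta> = complex_of_real (of_bool (\<alpha> = \<beta>) * (r \<alpha>)\<^sup>2)" for \<alpha> \<beta> :: nat
  define Z where "Z = gram n M"

  have l_zero: "l \<alpha> x = 0" if "r \<alpha> = 0" "\<alpha> < n" "x < m" for \<alpha> x
  proof -
    have "complex_of_real (\<Sum>x<m. (cmod (l \<alpha> x))\<^sup>2) = cinner m (l \<alpha>) (l \<alpha>)"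
      unfolding cinner_def of_real_sum
      by (intro sum.cong refl) (simp only: complex_norm_square mult.commute)
    also have "\<dots> = 0" using l[of \<alpha> \<alpha>] that by simp
    finally have "(\<Sum>x<m. (cmod (l \<alpha> x))\<^sup>2) = 0" by (simp only: of_real_eq_0_iff)
    then show ?thesis using that by (simp add: sum_nonneg_eq_0_iff)
  qed

  have "psd_form n (P s a)" for s a
    unfolding P_def by (rule psd_form_congruence[OF measurement_psd_form[OF X]])
  moreover have "psd_form n (Q t b)" for t b
    unfolding Q_def by (rule psd_form_cnj[OF psd_form_congruence[OF measurement_psd_form[OF Y]]])
  ultimately have "psd_form n (M k)" for k
    by (simp add: M_def split: sum.split)
  then have "Z \<in> DNN" unfolding Z_def by (rule gram_DNN)

  have "hs_inner n (P s a) (Q t b) = of_real (p a b s t)" for s a t b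
  proof -
    have "complex_of_real (p a b s t) = (\<Sum>i<n. \<Sum>j<n. ?X s a i j * sesq m (?Y t b) (K i) (K j))"
      unfolding p K_def
      using measurement_carrier[OF X] measurement_carrier[OF Y] \<psi> by (rule kronecker_quadratic_form)
    \<comment> \<open>Expand the rows of the coefficient matrix by the Schmidt decomposition; the
      coordinates of \<open>u\<close> will be absorbed by the first player's operator.\<close>
    also have "\<dots> = (\<Sum>i<n. \<Sum>j<n. \<Sum>\<alpha><n. \<Sum>\<beta><n.
        cnj (u \<alpha> i) * ?X s a i j * u \<beta> j * sesq m (?Y t b) (l \<alpha>) (l \<beta>))"
    proof (intro sum.cong refl)
      fix i j assume "i \<in> {..<n}" "j \<in> {..<n}"
      then have "sesq m (?Y t b) (K i) (K j)
          = sesq m (?Y t b) (\<lambda>x. \<Sum>\<alpha><n. u \<alpha> i * l \<alpha> x) (\<lambda>y. \<Sum>\<beta><n. u \<beta> j * l \<beta> y)"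
        by (intro sesq_cong) (simp_all add: K)
      then show "?X s a i j * sesq m (?Y t b) (K i) (K j) = (\<Sum>\<alpha><n. \<Sum>\<beta><n.
          cnj (u \<alpha> i) * ?X s a i j * u \<beta> j * sesq m (?Y t b) (l \<alpha>) (l \<beta>))"
        by (simp only: sesq_linear_combination sum_distrib_left) (simp only: mult_ac)
    qed
    also have "\<dots> = (\<Sum>\<alpha><n. \<Sum>\<beta><n. \<Sum>i<n. \<Sum>j<n.
        cnj (u \<alpha> i) * ?X s a i j * u \<beta> j * sesq m (?Y t b) (l \<alpha>) (l \<beta>))"
      by (rule sum_swap_pairs)
    also have "\<dots> = (\<Sum>\<alpha><n. \<Sum>\<beta><n. sesq n (?X s a) (u \<alpha>) (u \<beta>) * sesq m (?Y t b) (l \<alpha>) (l \<beta>))"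
      by (simp add: sesq_def[where n = n] sum_distrib_right)
    also have "\<dots> = hs_inner n (P s a) (Q t b)"
      unfolding hs_inner_def
    proof (intro sum.cong refl)
      fix \<alpha> \<beta> assume ab: "\<alpha> \<in> {..<n}" "\<beta> \<in> {..<n}"
      show "sesq n (?X s a) (u \<alpha>) (u \<beta>) * sesq m (?Y t b) (l \<alpha>) (l \<beta>) = P s a \<alpha> \<beta> * cnj (Q t b \<alpha> \<beta>)"
      proof (cases "r \<alpha> = 0 \<or> r \<beta> = 0")
        case True
        then have "(\<forall>x<m. l \<alpha> x = 0) \<or> (\<forall>x<m. l \<beta> x = 0)"
          using ab l_zero by auto
        then have "sesq m (?Y t b) (l \<alpha>) (l \<beta>) = 0"
          unfolding sesq_def by (auto intro!: sum.neutral)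
        with True show ?thesis unfolding P_def Q_def sesq_scale by auto
      next
        case False
        then show ?thesis unfolding P_def Q_def sesq_scale by (simp add: field_simps)
      qed
    qed
    finally show ?thesis ..
  qed
  then have "off_diagonal Z = p"
    by (intro ext) (simp add: off_diagonal_def Z_def gram_def M_def)

  have sumP: "(\<Sum>a\<in>UNIV. P s a \<alpha> \<beta>) = D \<alpha> \<beta>" if "\<alpha> < n" "\<beta> < n" for s \<alpha> \<beta>
  proof -
    have "(\<Sum>a\<in>UNIV. P s a \<alpha> \<beta>) = of_real (r \<alpha> * r \<beta>) * cinner n (u \<alpha>) (u \<beta>)"
      unfolding P_def sesq_scale by (simp add: sum_sesq_measurement[OF X] flip: sum_distrib_left)
    then show ?thesis using u that by (simp add: D_def orthonormal_def power2_eq_square)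
  qed
  have sumQ: "(\<Sum>b\<in>UNIV. Q t b \<alpha> \<beta>) = D \<alpha> \<beta>" if "\<alpha> < n" "\<beta> < n" for t \<alpha> \<beta>
  proof -
    have "(\<Sum>b\<in>UNIV. Q t b \<alpha> \<beta>) = of_real (inverse (r \<alpha>) * inverse (r \<beta>)) * cnj (cinner m (l \<alpha>) (l \<beta>))"
      unfolding Q_def sesq_scale
      by (simp add: sum_sesq_measurement[OF Y] flip: sum_distrib_left cnj_sum)
    \<comment> \<open>Off the diagonal the \<open>l \<alpha>\<close> are orthogonal. On it,
      \<open>r \<alpha> = 0\<close> makes both sides zero, and otherwise two of the four factors
      \<open>r \<alpha>\<close> cancel.\<close>
    then show ?thesis
      using l[OF that] by (cases "r \<alpha> = 0"; cases "\<alpha> = \<beta>")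
        (simp_all add: D_def power2_eq_square power4_eq_xxxx field_simps)
  qed
  have sumM: "(\<Sum>k\<in>block i. M k \<alpha> \<beta>) = D \<alpha> \<beta>" if "\<alpha> < n" "\<beta> < n" for i \<alpha> \<beta>
    using sumP[OF that] sumQ[OF that] by (cases i) (simp_all add: M_def del: block.simps)
  have bs: "block_sum i j Z = Re (hs_inner n D D)" for i j
    unfolding Z_def block_sum_gram hs_inner_def
    by (intro arg_cong[of _ _ Re] sum.cong refl) (simp add: sumM)
  \<comment> \<open>All block sums agree, so one of them suffices: for an arbitrary pair of
    questions it is the total probability of the answers under \<open>p\<close>.\<close>
  have "block_sum (Inl undefined) (Inr undefined) Z = 1"
  proof -
    have "Z $ Inl (s, a) $ Inr (t, b) = p a b s t" for a b s t
      using \<open>off_diagonal Z = p\<close> by (auto simp: off_diagonal_def)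
    then show ?thesis
      using assms by (simp add: block_sum_def quantum_correlations_def correlations_def del: block.simps)
  qed
  then have "block_sum i j Z = 1" for i j by (simp add: bs)
  with \<open>Z \<in> DNN\<close> \<open>off_diagonal Z = p\<close> show ?thesis by (intro that)
qed

section \<open>A deterministic strategy and the comparison of the suprema\<close>

lemma measurement_deterministic:
  "measurement 1 (\<lambda>a::'c::finite. Matrix.mat 1 1 (\<lambda>_. of_bool (a = c)))"
proof -
  have "psd_operator 1 (Matrix.mat 1 1 (\<lambda>_. of_bool (a = c)))" for a
  proof -
    let ?E = "Matrix.mat 1 1 (\<lambda>_. of_bool (a = c)) :: complex mat"
    have "mat_adjoint ?E = ?E"
      by (rule eq_matI) (auto simp: index_mat_adjoint, auto simp: mat_adjoint_def)
    moreover have "0 \<le> Re ((?E *\<^sub>v v) \<bullet>c v)" if "v \<in> carrier_vec 1" for v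
      using that by (auto simp: scalar_prod_def of_bool_def)
    ultimately show ?thesis by (simp add: psd_operator_def)
  qed
  moreover have "Matrix.mat 1 1 (\<lambda>ij. \<Sum>a\<in>UNIV. Matrix.mat 1 1 (\<lambda>_. of_bool (a = c)) $$ ij) = (1\<^sub>m 1 :: complex mat)"
    by (rule eq_matI) (auto simp: of_bool_def)
  ultimately show ?thesis by (simp add: measurement_def)
qed

text \<open>Both players hold one-dimensional systems and always give the fixed answer
  \<open>undefined\<close>.\<close>

lemma quantum_correlations_nonempty:
  "(quantum_correlations :: ('s::finite, 't::finite, 'a::finite, 'b::finite) correlation set) \<noteq> {}"
proof -
  define p :: "('s, 't, 'a, 'b) correlation" where
    "p a b s t = of_bool (a = undefined) * of_bool (b = undefined)" for a b s t
  have delta: "(\<Sum>x\<in>UNIV. of_bool (x = c)) = (1 :: real)" for c :: "'c::finite"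
    by (simp add: of_bool_def)
  define X :: "'s \<Rightarrow> 'a \<Rightarrow> complex mat" where "X s a = Matrix.mat 1 1 (\<lambda>_. of_bool (a = undefined))" for s a
  define Y :: "'t \<Rightarrow> 'b \<Rightarrow> complex mat" where "Y t b = Matrix.mat 1 1 (\<lambda>_. of_bool (b = undefined))" for t b
  define \<psi> :: "complex Matrix.vec" where "\<psi> = Matrix.vec 1 (\<lambda>_. 1)"
  have \<psi>: "\<psi> \<in> carrier_vec (1 * 1)" by (simp add: \<psi>_def)
  have norm: "\<psi> \<bullet>c \<psi> = 1" by (simp add: \<psi>_def scalar_prod_def)
  have X: "measurement 1 (X s)" and Y: "measurement 1 (Y t)" for s t
    unfolding X_def Y_def by (rule measurement_deterministic)+
  have "complex_of_real (p a b s t) = (kronecker (X s a) (Y t b) *\<^sub>v \<psi>) \<bullet>c \<psi>" for a b s t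
    unfolding kronecker_quadratic_form[OF measurement_carrier[OF X] measurement_carrier[OF Y] \<psi>]
    by (simp add: sesq_def p_def X_def Y_def \<psi>_def)
  moreover have "p \<in> correlations"
    using delta by (simp add: correlations_def p_def flip: sum_distrib_left)
  ultimately have "p \<in> quantum_correlations"
    unfolding quantum_correlations_def using \<psi> norm X Y by blast
  then show ?thesis by blast
qed

theorem proposition4p4:
  fixes \<pi> :: "'s::finite \<Rightarrow> 't::finite \<Rightarrow> real"
    and V :: "'a::finite \<Rightarrow> 'b::finite \<Rightarrow> 's \<Rightarrow> 't \<Rightarrow> bool"
  assumes "prob_distribution \<pi>"
  shows "quantum_value \<pi> V \<le> DNN_value \<pi> V \<and> DNN_value \<pi> V \<le> nonsignaling_value \<pi> V"
proof
  let ?F = "{Z :: real ^ ('s \<times> 'a + 't \<times> 'b) ^ ('s \<times> 'a + 't \<times> 'b). Z \<in> DNN \<and> (\<forall>i j. block_sum i j Z = 1)}"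
  let ?tr = "\<lambda>Z. Determinants.trace (sym_cost \<pi> V ** Z)"
  have ns: "off_diagonal Z \<in> nonsignaling_correlations" "?tr Z = winning_prob \<pi> V (off_diagonal Z)"
    if "Z \<in> ?F" for Z
    using that by (auto intro: off_diagonal_nonsignaling trace_sym_cost)
  have le1: "winning_prob \<pi> V p \<le> 1" if "p \<in> nonsignaling_correlations" for p
    using that by (auto intro!: winning_prob_le_1[OF assms] simp: nonsignaling_correlations_def)
  have feasible: "\<exists>Z\<in>?F. off_diagonal Z = p" if "p \<in> quantum_correlations" for p
    by (rule quantum_correlation_DNN[OF that]) blast
  \<comment> \<open>The bound 1 on nonsignaling winning probabilities passes to the traces through
    \<open>off_diagonal\<close>.\<close>
  have "bdd_above (?tr ` ?F)"
    by (rule bdd_aboveI2[where M = 1]) (simp only: ns le1)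
  moreover have "\<exists>Z\<in>?F. winning_prob \<pi> V p \<le> ?tr Z" if p: "p \<in> quantum_correlations" for p
  proof -
    obtain Z where "Z \<in> ?F" "off_diagonal Z = p" using feasible[OF p] by blast
    then show ?thesis using ns(2) by (intro bexI[of _ Z]) simp_all
  qed
  ultimately show "quantum_value \<pi> V \<le> DNN_value \<pi> V"
    unfolding quantum_value_def DNN_value_def
    by (intro cSUP_mono quantum_correlations_nonempty)
  \<comment> \<open>The matrix built from any quantum correlation shows that the feasible set is
    nonempty, as \<open>cSUP_mono\<close> requires of its left-hand side.\<close>
  obtain p :: "('s, 't, 'a, 'b) correlation" where "p \<in> quantum_correlations"
    using quantum_correlations_nonempty by blast
  then have "?F \<noteq> {}" using feasible by blast
  moreover have "bdd_above (winning_prob \<pi> V ` nonsignaling_correlations)"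
    using le1 by (rule bdd_aboveI2)
  moreover have "\<exists>p\<in>nonsignaling_correlations. ?tr Z \<le> winning_prob \<pi> V p" if "Z \<in> ?F" for Z
    using ns[OF that] by (intro bexI[of _ "off_diagonal Z"]) simp_all
  ultimately show "DNN_value \<pi> V \<le> nonsignaling_value \<pi> V"
    unfolding DNN_value_def nonsignaling_value_def
    by (intro cSUP_mono)
qed

end
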